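(* Let $k\ge 2$ and $n\ge 1$ be integers, $N=kn$, and let $\varphi$ be a shuffling weight function for $N$ and $k$, with its associated periodic poset. A stack $a_0,\ldots,a_{N-1}$ with labels from a finite totally ordered set is periodic under the shuffling if and only if, for every edge of the periodic poset joining subscripts $A$ and $B$ with $\varphi(A)>\varphi(B)$, one has $a_B\succeq a_A$.
   Context: A stack of $N=kn$ cards is a sequence $a_0,a_1,\ldots,a_{N-1}$ of labels from a finite totally ordered set $\mathcal{A}_1\succ\mathcal{A}_2\succ\cdots\succ\mathcal{A}_j$ (labels may be repeated). The shuffling sends it to the stack $b_0,\ldots,b_{N-1}$ where, for each $\ell\in\{0,1,\ldots,n-1\}$, the labels $b_{k\ell},b_{k\ell+1},\ldots,b_{k\ell+(k-1)}$ are the labels $a_\ell,a_{\ell+n},\ldots,a_{\ell+(k-1)n}$ (with multiplicity) sorted so that $b_{k\ell}\succeq b_{k\ell+1}\succeq\cdots\succeq b_{k\ell+(k-1)}$. A stack is periodic if it returns to itself after some positive number of shuffles. For $\ell\in\{0,\ldots,n-1\}$ the $\ell$-th column is the set of subscripts $\{\ell,\ell+n,\ldots,\ell+(k-1)n\}$ and the $\ell$-th block is $\{k\ell,k\ell+1,\ldots,k\ell+(k-1)\}$. A shuffling weight function is a map $\varphi:\{0,\ldots,N-1\}\to\mathbb{Z}$ such that for all $\ell\in\{0,1,\ldots,n-1\}$: (i) $\{\varphi(\ell),\varphi(\ell+n),\ldots,\varphi(\ell+(k-1)n)\}=\{\varphi(k\ell),\varphi(k\ell+1),\ldots,\varphi(k\ell+(k-1))\}$;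 and (ii) $\varphi(k\ell)<\varphi(k\ell+1)<\cdots<\varphi(k\ell+(k-1))$. (In particular $\varphi$ is injective on each column and on each block.) Let $\pi$ be the permutation of $\{0,\ldots,N-1\}$ sending each subscript $x$ of the $\ell$-th column to the unique subscript $\pi(x)$ of the $\ell$-th block with $\varphi(\pi(x))=\varphi(x)$. The periodic poset has the subscripts $0,\ldots,N-1$ as elements, with $A$ placed at level $\varphi(A)$. Subscripts $A$ and $B$ with $\varphi(A)>\varphi(B)$ are joined by an edge if and only if there is an integer $s\ge 0$ such that $c_s=\pi^s(A)$ and $d_s=\pi^s(B)$ lie in the same column and there is no subscript $e$ in that column with $\varphi(e)$ strictly between $\varphi(d_s)$ and $\varphi(c_s)$. *)

theory Defs
  imports Main
begin

definition column :: "nat \<Rightarrow> nat \<Rightarrow> nat \<Rightarrow> nat set" where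
  "column k n l = {l + i * n | i. i < k}"

definition block :: "nat \<Rightarrow> nat \<Rightarrow> nat set" where
  "block k l = {k * l + i | i. i < k}"

(* A stack is a list of length k * n. The order on labels is that of the type, larger
   labels being higher; sort is increasing, hence the rev. *)

definition shuffle :: "nat \<Rightarrow> nat \<Rightarrow> 'a::linorder list \<Rightarrow> 'a list" where
  "shuffle k n a = concat (map (\<lambda>l. rev (sort (map (\<lambda>i. a ! (l + i * n)) [0..<k]))) [0..<n])"

definition periodic :: "nat \<Rightarrow> nat \<Rightarrow> 'a::linorder list \<Rightarrow> bool" where
  "periodic k n a \<longleftrightarrow> (\<exists>t>0. (shuffle k n ^^ t) a = a)"

(* Only the values of a weight function on {..<k * n} are constrained (and used below). *)

definition shuffling_weight :: "nat \<Rightarrow> nat \<Rightarrow> (nat \<Rightarrow> int) \<Rightarrow> bool" where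
  "shuffling_weight k n \<phi> \<longleftrightarrow>
     (\<forall>l<n. \<phi> ` column k n l = \<phi> ` block k l \<and> strict_mono_on (block k l) \<phi>)"

(* A subscript x < k * n lies in the column with index x mod n. The map is extended by the
   identity to all of nat. *)

definition weight_perm :: "nat \<Rightarrow> nat \<Rightarrow> (nat \<Rightarrow> int) \<Rightarrow> nat \<Rightarrow> nat" where
  "weight_perm k n \<phi> x =
     (if x < k * n then (THE y. y \<in> block k (x mod n) \<and> \<phi> y = \<phi> x) else x)"

(* The edge joining A and B, oriented so that A is the subscript at the higher level. *)

definition periodic_poset_edge :: "nat \<Rightarrow> nat \<Rightarrow> (nat \<Rightarrow> int) \<Rightarrow> nat \<Rightarrow> nat \<Rightarrow> bool" where
  "periodic_poset_edge k n \<phi> A B \<longleftrightarrow>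
     A < k * n \<and> B < k * n \<and> \<phi> A > \<phi> B \<and>
     (\<exists>s. let c = (weight_perm k n \<phi> ^^ s) A; d = (weight_perm k n \<phi> ^^ s) B in
        \<exists>l<n. c \<in> column k n l \<and> d \<in> column k n l \<and>
          \<not> (\<exists>e\<in>column k n l. \<phi> d < \<phi> e \<and> \<phi> e < \<phi> c))"

end

theory Submission
  imports Defs "HOL-Combinatorics.Cycles"
begin

text \<open>
  Write \<open>\<pi>\<close> for the weight permutation. It preserves \<open>\<phi>\<close> and carries every column onto the
  corresponding block. Say that a stack is transported when its shuffle puts the label of \<open>x\<close>
  at \<open>\<pi> x\<close>, for every \<open>x\<close>. Since blocks are sorted and \<open>\<phi>\<close> increases along blocks, a stack is
  transported exactly when, inside each column, labels weakly decrease as \<open>\<phi>\<close> grows. An edge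
  of the poset is a pair of \<open>\<phi>\<close>-neighbours in a column, moved back by a power of \<open>\<pi>\<close>; so the
  edge condition says that the stack and all its successive shuffles are transported.

  If all of them are transported, then \<open>s\<close> shuffles act on the stack as \<open>\<pi>\<^sup>s\<close>, and the stack
  returns because \<open>\<pi>\<close> has finite order.

  Conversely, fix a label \<open>c\<close> and take as energy of a stack the sum of \<open>\<phi> x\<close> over all \<open>x\<close>
  with label at least \<open>c\<close>. Moving the labels by \<open>\<pi>\<close> keeps the energy; the shuffle instead puts
  the labels that are at least \<open>c\<close> on the lowest levels of each block. So the energy never
  increases (lemma \<open>energy_shuffle_le\<close>), and if it stays constant for every \<open>c\<close> the stack is
  transported (lemma \<open>transported_if_energy_constant\<close>). Along a periodic orbit each energy is
  constant. Both energy lemmas rest on one fact about integers: among the subsets of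
  given size of a finite set, the initial segment has the least sum, and it alone does (lemma
  \<open>initial_segment_sum_less\<close>). The sets in question are the levels of the labels at least \<open>c\<close>,
  in a column before the shuffle and in the block with the same levels after it.
\<close>

section \<open>Initial segments of finite sets of integers\<close>

text \<open>Every element lost from the initial segment is smaller than every element gained.\<close>

lemma initial_segment_sum_less:
  fixes V W T :: "int set"
  assumes "finite T" "V \<subseteq> T" "W \<subseteq> T" "card V = card W" "V \<noteq> W"
    and initial: "\<And>w t. w \<in> W \<Longrightarrow> t \<in> T \<Longrightarrow> t < w \<Longrightarrow> t \<in> W"
  shows "\<Sum>W < \<Sum>V"
proof -
  have fin: "finite V" "finite W" using assms(1-3) by (auto intro: finite_subset)
  have card_eq: "card (W - V) = card (V - W)"
    using fin assms(4) by (simp add: card_Diff_subset_Int Int_commute)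
  have ne: "W - V \<noteq> {}"
  proof
    assume "W - V = {}"
    then have "W \<subseteq> V" by blast
    then show False using card_subset_eq[OF fin(1)] assms(4,5) by auto
  qed
  define m where "m = Max (W - V)"
  have m: "m \<in> W - V" unfolding m_def using fin ne by (intro Max_in) auto
  have below: "d \<le> m" if "d \<in> W - V" for d
    unfolding m_def using fin that by (intro Max_ge) auto
  have above: "m + 1 \<le> f" if f: "f \<in> V - W" for f
  proof -
    have "\<not> f < m" using initial[of m f] m f assms(2) by blast
    moreover have "f \<noteq> m" using m f by blast
    ultimately show ?thesis by linarith
  qed
  have "card (W - V) > 0" using ne fin by (simp add: card_gt_0_iff)
  have "\<Sum>(W - V) \<le> int (card (W - V)) * m"
    using sum_bounded_above[of "W - V" "\<lambda>d. d" m] below by simp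
  also have "\<dots> < int (card (V - W)) * (m + 1)"
    using \<open>card (W - V) > 0\<close> card_eq by (simp add: distrib_left)
  also have "\<dots> \<le> \<Sum>(V - W)"
    using sum_bounded_below[of "V - W" "m + 1" "\<lambda>d. d"] above by simp
  finally have less: "\<Sum>(W - V) < \<Sum>(V - W)" .
  have "\<Sum>W = \<Sum>(W \<inter> V) + \<Sum>(W - V)" "\<Sum>V = \<Sum>(W \<inter> V) + \<Sum>(V - W)"
    using sum.Int_Diff[of W "\<lambda>x. x" V] sum.Int_Diff[of V "\<lambda>x. x" W] fin
    by (auto simp: Int_commute)
  then show ?thesis using less by simp
qed

lemma initial_segments_eq:
  fixes V W T :: "int set"
  assumes "finite T" "V \<subseteq> T" "W \<subseteq> T" "card V = card W"
    and "\<And>w t. w \<in> W \<Longrightarrow> t \<in> T \<Longrightarrow> t < w \<Longrightarrow> t \<in> W"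
    and "\<And>v t. v \<in> V \<Longrightarrow> t \<in> T \<Longrightarrow> t < v \<Longrightarrow> t \<in> V"
  shows "V = W"
proof (rule ccontr)
  assume "V \<noteq> W"
  then have "\<Sum>W < \<Sum>V" "\<Sum>V < \<Sum>W"
    using initial_segment_sum_less[of T V W] initial_segment_sum_less[of T W V] assms by auto
  then show False by simp
qed

section \<open>Columns, blocks and the labels of a shuffled stack\<close>

lemma mem_column_iff:
  assumes "l < n"
  shows "x \<in> column k n l \<longleftrightarrow> x < k * n \<and> x mod n = l"
proof
  assume "x \<in> column k n l"
  then obtain i where i: "x = l + i * n" "i < k" by (auto simp: column_def)
  have "l + i * n < Suc i * n" using assms by simp
  also have "\<dots> \<le> k * n" using i by (intro mult_right_mono) auto
  finally show "x < k * n \<and> x mod n = l" using i assms by simp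
next
  assume x: "x < k * n \<and> x mod n = l"
  then have "x = l + (x div n) * n" "x div n < k"
    by (auto simp: less_mult_imp_div_less)
  then show "x \<in> column k n l" unfolding column_def by blast
qed

lemma mem_block_iff:
  assumes "k > 0"
  shows "y \<in> block k l \<longleftrightarrow> y div k = l"
proof
  assume "y div k = l"
  then have "y = k * l + y mod k" "y mod k < k" using assms by auto
  then show "y \<in> block k l" unfolding block_def by blast
qed (use assms in \<open>auto simp: block_def\<close>)

lemma length_concat_map_const:
  assumes "\<And>l. l < n \<Longrightarrow> length (f l) = k"
  shows "length (concat (map f [0..<n])) = k * n"
  using assms by (induction n) auto

lemma nth_concat_map_const:
  assumes "\<And>l. l < n \<Longrightarrow> length (f l) = k" and "l < n" "i < k"
  shows "concat (map f [0..<n]) ! (k * l + i) = f l ! i"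
  using assms
proof (induction n)
  case (Suc n)
  have len: "length (concat (map f [0..<n])) = k * n"
    by (rule length_concat_map_const) (use Suc.prems in auto)
  show ?case
  proof (cases "l = n")
    case True
    then show ?thesis using len Suc.prems by (simp add: nth_append)
  next
    case False
    then have "l < n" using Suc.prems by simp
    have "k * l + i < k * Suc l" using Suc.prems by simp
    also have "\<dots> \<le> k * n" using \<open>l < n\<close> by (intro mult_left_mono) auto
    finally show ?thesis using Suc \<open>l < n\<close> len by (simp add: nth_append)
  qed
qed simp

lemma length_shuffle [simp]: "length (shuffle k n a) = k * n"
  unfolding shuffle_def by (rule length_concat_map_const) simp

lemma nth_shuffle:
  assumes "l < n" "i < k"
  shows "shuffle k n a ! (k * l + i) = rev (sort (map (\<lambda>i. a ! (l + i * n)) [0..<k])) ! i"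
  unfolding shuffle_def
  using nth_concat_map_const[of n "\<lambda>l. rev (sort (map (\<lambda>i. a ! (l + i * n)) [0..<k]))" k l i]
    assms by simp

lemma shuffle_block_decreasing:
  assumes "l < n" "y \<in> block k l" "z \<in> block k l" "y \<le> z"
  shows "shuffle k n a ! z \<le> shuffle k n a ! y"
proof -
  let ?xs = "sort (map (\<lambda>i. a ! (l + i * n)) [0..<k])"
  obtain i j where ij: "y = k * l + i" "i < k" "z = k * l + j" "j < k"
    using assms(2,3) by (auto simp: block_def)
  have "?xs ! (k - Suc j) \<le> ?xs ! (k - Suc i)"
    using assms(4) ij by (intro sorted_nth_mono) auto
  then show ?thesis using ij assms(1) by (simp add: nth_shuffle rev_nth)
qed

definition high :: "'a::linorder list \<Rightarrow> 'a \<Rightarrow> nat set \<Rightarrow> nat set" where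
  "high a c X = {x \<in> X. c \<le> a ! x}"

text \<open>Sorting a column into a block keeps the multiset of labels, hence every such count.\<close>

lemma card_high_shuffle:
  assumes "l < n"
  shows "card (high (shuffle k n a) c (block k l)) = card (high a c (column k n l))"
proof -
  let ?xs = "map (\<lambda>i. a ! (l + i * n)) [0..<k]"
  have "high (shuffle k n a) c (block k l)
      = (\<lambda>i. k * l + i) ` {i. i < k \<and> c \<le> rev (sort ?xs) ! i}"
    using assms by (auto simp: high_def block_def nth_shuffle)
  then have "card (high (shuffle k n a) c (block k l)) = card {i. i < k \<and> c \<le> rev (sort ?xs) ! i}"
    by (simp add: card_image)
  also have "\<dots> = length (filter ((\<le>) c) (rev (sort ?xs)))"
    by (simp add: length_filter_conv_card)
  also have "\<dots> = length (filter ((\<le>) c) ?xs)"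
    by (simp only: rev_filter[symmetric] filter_sort length_rev length_sort)
  also have "\<dots> = card {i. i < k \<and> c \<le> ?xs ! i}"
    by (simp add: length_filter_conv_card)
  also have "{i. i < k \<and> c \<le> ?xs ! i} = {i. i < k \<and> c \<le> a ! (l + i * n)}"
    by auto
  also have "card \<dots> = card ((\<lambda>i. l + i * n) ` {i. i < k \<and> c \<le> a ! (l + i * n)})"
    using assms by (intro card_image[symmetric]) (auto simp: inj_on_def)
  also have "(\<lambda>i. l + i * n) ` {i. i < k \<and> c \<le> a ! (l + i * n)} = high a c (column k n l)"
    by (auto simp: high_def column_def)
  finally show ?thesis .
qed

section \<open>The weight permutation\<close>

locale weighted_shuffling =
  fixes k n :: nat and \<phi> :: "nat \<Rightarrow> int"
  assumes k_pos: "k > 0" and n_pos: "n > 0" and weight: "shuffling_weight k n \<phi>"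
begin

abbreviation \<pi> :: "nat \<Rightarrow> nat" where "\<pi> \<equiv> weight_perm k n \<phi>"

lemma image_column: "l < n \<Longrightarrow> \<phi> ` column k n l = \<phi> ` block k l"
  using weight by (auto simp: shuffling_weight_def)

lemma strict_mono_block: "l < n \<Longrightarrow> strict_mono_on (block k l) \<phi>"
  using weight by (auto simp: shuffling_weight_def)

lemma inj_on_block: "l < n \<Longrightarrow> inj_on \<phi> (block k l)"
  by (rule strict_mono_on_imp_inj_on[OF strict_mono_block])

text \<open>The weights of the column fill those of the block, which are \<open>k\<close> distinct integers.\<close>

lemma inj_on_column:
  assumes "l < n"
  shows "inj_on \<phi> (column k n l)"
proof (rule eq_card_imp_inj_on)
  have col: "column k n l = (\<lambda>i. l + i * n) ` {..<k}" by (auto simp: column_def)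
  have blk: "block k l = (\<lambda>i. k * l + i) ` {..<k}" by (auto simp: block_def)
  show "finite (column k n l)" by (simp add: col)
  have "card (column k n l) = k"
    unfolding col using n_pos by (subst card_image) (auto simp: inj_on_def)
  moreover have "card (block k l) = k"
    unfolding blk by (subst card_image) (auto simp: inj_on_def)
  ultimately show "card (\<phi> ` column k n l) = card (column k n l)"
    using image_column[OF assms] card_image[OF inj_on_block[OF assms]] by simp
qed

lemma block_subset: "l < n \<Longrightarrow> y \<in> block k l \<Longrightarrow> y < k * n"
  using k_pos by (auto simp: mem_block_iff div_less_iff_less_mult mult.commute)

lemma mem_own_column: "x < k * n \<Longrightarrow> x \<in> column k n (x mod n)"
  using n_pos by (simp add: mem_column_iff)

lemma weight_perm_spec:
  assumes "x < k * n"
  shows "\<pi> x \<in> block k (x mod n)" "\<phi> (\<pi> x) = \<phi> x"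
proof -
  have l: "x mod n < n" using n_pos by simp
  have "\<phi> x \<in> \<phi> ` block k (x mod n)"
    using image_column[OF l] mem_own_column[OF assms] by blast
  then obtain y where "y \<in> block k (x mod n)" "\<phi> y = \<phi> x" by auto
  then have "\<exists>!y. y \<in> block k (x mod n) \<and> \<phi> y = \<phi> x"
    using inj_on_block[OF l] by (metis inj_onD)
  from theI'[OF this] assms
  show "\<pi> x \<in> block k (x mod n)" "\<phi> (\<pi> x) = \<phi> x"
    by (auto simp: weight_perm_def)
qed

lemma weight_perm_less: "x < k * n \<Longrightarrow> \<pi> x < k * n"
  using weight_perm_spec(1)[of x] n_pos by (auto intro: block_subset[of "x mod n"])

lemma weight_perm_permutes: "\<pi> permutes {..<k * n}"
proof (rule bij_imp_permutes)
  have "inj_on \<pi> {..<k * n}"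
  proof (rule inj_onI)
    fix x y assume xy: "x \<in> {..<k * n}" "y \<in> {..<k * n}" "\<pi> x = \<pi> y"
    then have "x mod n = y mod n" "\<phi> x = \<phi> y"
      using weight_perm_spec[of x] weight_perm_spec[of y] k_pos by (auto simp: mem_block_iff)
    then show "x = y"
      using inj_on_column[of "y mod n"] mem_own_column[of x] mem_own_column[of y] n_pos xy
      by (auto dest: inj_onD)
  qed
  moreover have "\<pi> ` {..<k * n} \<subseteq> {..<k * n}" using weight_perm_less by auto
  ultimately show "bij_betw \<pi> {..<k * n} {..<k * n}"
    unfolding bij_betw_def using endo_inj_surj[of "{..<k * n}" \<pi>] by blast
qed (auto simp: weight_perm_def)

lemma funpow_weight_perm:
  assumes "x < k * n"
  shows "(\<pi> ^^ s) x < k * n" "\<phi> ((\<pi> ^^ s) x) = \<phi> x"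
  using assms by (induction s) (auto simp: weight_perm_less weight_perm_spec)

section \<open>Transported stacks\<close>

definition transported :: "'a::linorder list \<Rightarrow> bool" where
  "transported a \<longleftrightarrow> (\<forall>x<k * n. shuffle k n a ! \<pi> x = a ! x)"

lemma levels_high_shuffle_initial:
  assumes "l < n" "w \<in> \<phi> ` high (shuffle k n a) c (block k l)" "t \<in> \<phi> ` block k l" "t < w"
  shows "t \<in> \<phi> ` high (shuffle k n a) c (block k l)"
proof -
  obtain z where z: "z \<in> block k l" "c \<le> shuffle k n a ! z" "w = \<phi> z"
    using assms(2) by (auto simp: high_def)
  obtain y where y: "y \<in> block k l" "t = \<phi> y" using assms(3) by blast
  have "y \<le> z"
  proof (rule ccontr)
    assume "\<not> y \<le> z"
    then have "\<phi> z < \<phi> y" using strict_mono_onD[OF strict_mono_block] assms(1) y z by simp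
    then show False using assms(4) y z by simp
  qed
  then show ?thesis
    using shuffle_block_decreasing[OF assms(1) y(1) z(1), of a] y z by (auto simp: high_def)
qed

lemma card_levels_high_shuffle:
  assumes "l < n"
  shows "card (\<phi> ` high a c (column k n l)) = card (\<phi> ` high (shuffle k n a) c (block k l))"
proof -
  have "inj_on \<phi> (high a c (column k n l))" "inj_on \<phi> (high (shuffle k n a) c (block k l))"
    using inj_on_column[OF assms] inj_on_block[OF assms] by (auto simp: high_def inj_on_def)
  then show ?thesis by (simp add: card_image card_high_shuffle[OF assms])
qed

lemma finite_column: "finite (column k n l)" and finite_block: "finite (block k l)"
  by (auto simp: column_def block_def)

text \<open>A label is determined by the thresholds below it, so it suffices to compare levels.\<close>

lemma transported_if_levels_eq:
  assumes "\<And>l c. l < n \<Longrightarrow>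
    \<phi> ` high a c (column k n l) = \<phi> ` high (shuffle k n a) c (block k l)"
  shows "transported a"
  unfolding transported_def
proof (intro allI impI)
  fix x assume x: "x < k * n"
  let ?l = "x mod n"
  have l: "?l < n" using n_pos by simp
  have "c \<le> a ! x \<longleftrightarrow> c \<le> shuffle k n a ! \<pi> x" for c
  proof -
    have "c \<le> a ! x \<longleftrightarrow> \<phi> x \<in> \<phi> ` high a c (column k n ?l)"
      using mem_own_column[OF x] inj_on_column[OF l] by (auto simp: high_def dest: inj_onD)
    also have "\<dots> \<longleftrightarrow> \<phi> (\<pi> x) \<in> \<phi> ` high (shuffle k n a) c (block k ?l)"
      using assms[OF l] weight_perm_spec[OF x] by simp
    also have "\<dots> \<longleftrightarrow> c \<le> shuffle k n a ! \<pi> x"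
      using weight_perm_spec(1)[OF x] inj_on_block[OF l] by (auto simp: high_def dest: inj_onD)
    finally show ?thesis .
  qed
  then show "shuffle k n a ! \<pi> x = a ! x" by (metis order_antisym order_refl)
qed

lemma transported_if_decreasing:
  assumes dec: "\<And>l x y. l < n \<Longrightarrow> x \<in> column k n l \<Longrightarrow> y \<in> column k n l \<Longrightarrow> \<phi> y < \<phi> x
    \<Longrightarrow> a ! x \<le> a ! y"
  shows "transported a"
proof (rule transported_if_levels_eq)
  fix l c assume l: "l < n"
  show "\<phi> ` high a c (column k n l) = \<phi> ` high (shuffle k n a) c (block k l)"
  proof (rule initial_segments_eq[where T = "\<phi> ` block k l"])
    fix v t assume "v \<in> \<phi> ` high a c (column k n l)" "t \<in> \<phi> ` block k l" "t < v"
    then obtain x y where "x \<in> column k n l" "c \<le> a ! x" "v = \<phi> x"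
      "y \<in> column k n l" "t = \<phi> y" "\<phi> y < \<phi> x"
      unfolding image_column[OF l, symmetric] by (auto simp: high_def)
    then show "t \<in> \<phi> ` high a c (column k n l)"
      using dec[OF l, of x y] by (auto simp: high_def)
  next
    show "\<phi> ` high a c (column k n l) \<subseteq> \<phi> ` block k l"
      unfolding image_column[OF l, symmetric] by (auto simp: high_def)
  next
    fix w t assume "w \<in> \<phi> ` high (shuffle k n a) c (block k l)" "t \<in> \<phi> ` block k l" "t < w"
    then show "t \<in> \<phi> ` high (shuffle k n a) c (block k l)"
      by (rule levels_high_shuffle_initial[OF l])
  next
    show "card (\<phi> ` high a c (column k n l)) = card (\<phi> ` high (shuffle k n a) c (block k l))"
      by (rule card_levels_high_shuffle[OF l])
  qed (auto simp: high_def finite_block)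
qed

lemma transported_decreasing:
  assumes "transported a" "l < n" "x \<in> column k n l" "y \<in> column k n l" "\<phi> y < \<phi> x"
  shows "a ! x \<le> a ! y"
proof -
  have xy: "x < k * n" "y < k * n" "x mod n = l" "y mod n = l"
    using assms by (auto simp: mem_column_iff)
  have blk: "\<pi> x \<in> block k l" "\<pi> y \<in> block k l"
    using weight_perm_spec(1)[OF xy(1)] weight_perm_spec(1)[OF xy(2)] xy(3,4) by simp_all
  have "\<pi> y \<le> \<pi> x"
  proof (rule ccontr)
    assume "\<not> \<pi> y \<le> \<pi> x"
    then have "\<phi> (\<pi> x) < \<phi> (\<pi> y)"
      using strict_mono_onD[OF strict_mono_block[OF assms(2)]] blk by simp
    then show False using weight_perm_spec(2) xy assms(5) by simp
  qed
  then show ?thesis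
    using shuffle_block_decreasing[OF assms(2) blk(2,1), of a] assms(1) xy
    by (simp add: transported_def)
qed

text \<open>As long as the stacks met are transported, shuffling acts as a power of \<open>\<pi>\<close>.\<close>

lemma nth_funpow_shuffle:
  assumes "\<And>r. r < s \<Longrightarrow> transported ((shuffle k n ^^ r) a)" "x < k * n"
  shows "(shuffle k n ^^ s) a ! (\<pi> ^^ s) x = a ! x"
  using assms
proof (induction s)
  case (Suc s)
  then have "transported ((shuffle k n ^^ s) a)" by simp
  then show ?case
    using Suc funpow_weight_perm(1)[of x s] by (simp add: transported_def)
qed simp

section \<open>The energy of a stack\<close>

definition energy :: "'a::linorder \<Rightarrow> 'a list \<Rightarrow> int" where
  "energy c a = sum \<phi> (high a c {..<k * n})"

lemma energy_columns: "energy c a = (\<Sum>l<n. \<Sum>(\<phi> ` high a c (column k n l)))"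
proof -
  have "energy c a = (\<Sum>l<n. sum \<phi> {x \<in> high a c {..<k * n}. x mod n = l})"
    unfolding energy_def using n_pos
    by (intro sum.group[symmetric]) (auto simp: high_def)
  also have "\<dots> = (\<Sum>l<n. \<Sum>(\<phi> ` high a c (column k n l)))"
  proof (rule sum.cong)
    fix l assume "l \<in> {..<n}"
    then have l: "l < n" by simp
    have "{x \<in> high a c {..<k * n}. x mod n = l} = high a c (column k n l)"
      using l by (auto simp: high_def mem_column_iff)
    moreover have "inj_on \<phi> (high a c (column k n l))"
      using inj_on_column[OF l] by (auto simp: high_def inj_on_def)
    ultimately show "sum \<phi> {x \<in> high a c {..<k * n}. x mod n = l} = \<Sum>(\<phi> ` high a c (column k n l))"
      by (simp add: sum.reindex)
  qed simp
  finally show ?thesis .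
qed

lemma energy_blocks: "energy c a = (\<Sum>l<n. \<Sum>(\<phi> ` high a c (block k l)))"
proof -
  have "energy c a = (\<Sum>l<n. sum \<phi> {x \<in> high a c {..<k * n}. x div k = l})"
    unfolding energy_def using k_pos
    by (intro sum.group[symmetric])
      (auto simp: high_def div_less_iff_less_mult mult.commute)
  also have "\<dots> = (\<Sum>l<n. \<Sum>(\<phi> ` high a c (block k l)))"
  proof (rule sum.cong)
    fix l assume "l \<in> {..<n}"
    then have l: "l < n" by simp
    have "{x \<in> high a c {..<k * n}. x div k = l} = high a c (block k l)"
      using block_subset[OF l] k_pos by (auto simp: high_def mem_block_iff)
    moreover have "inj_on \<phi> (high a c (block k l))"
      using inj_on_block[OF l] by (auto simp: high_def inj_on_def)
    ultimately show "sum \<phi> {x \<in> high a c {..<k * n}. x div k = l} = \<Sum>(\<phi> ` high a c (block k l))"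
      by (simp add: sum.reindex)
  qed simp
  finally show ?thesis .
qed

text \<open>
  The levels of the high labels of a block form an initial segment of the levels available
  there, and the column supplies a set of the same size among the same levels.
\<close>

lemma levels_sum_shuffle_less:
  assumes l: "l < n"
    and ne: "\<phi> ` high a c (column k n l) \<noteq> \<phi> ` high (shuffle k n a) c (block k l)"
  shows "\<Sum>(\<phi> ` high (shuffle k n a) c (block k l)) < \<Sum>(\<phi> ` high a c (column k n l))"
proof (rule initial_segment_sum_less[where T = "\<phi> ` block k l"])
  show "\<phi> ` high a c (column k n l) \<subseteq> \<phi> ` block k l"
    unfolding image_column[OF l, symmetric] by (auto simp: high_def)
next
  fix w t assume "w \<in> \<phi> ` high (shuffle k n a) c (block k l)" "t \<in> \<phi> ` block k l" "t < w"
  then show "t \<in> \<phi> ` high (shuffle k n a) c (block k l)"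
    by (rule levels_high_shuffle_initial[OF l])
next
  show "card (\<phi> ` high a c (column k n l)) = card (\<phi> ` high (shuffle k n a) c (block k l))"
    by (rule card_levels_high_shuffle[OF l])
next
  show "\<phi> ` high a c (column k n l) \<noteq> \<phi> ` high (shuffle k n a) c (block k l)" by (rule ne)
qed (auto simp: high_def finite_block)

lemma levels_sum_shuffle_le:
  assumes "l < n"
  shows "\<Sum>(\<phi> ` high (shuffle k n a) c (block k l)) \<le> \<Sum>(\<phi> ` high a c (column k n l))"
  using levels_sum_shuffle_less[OF assms, of a c] by fastforce

lemma energy_shuffle_le: "energy c (shuffle k n a) \<le> energy c a"
  unfolding energy_columns[of c a] energy_blocks[of c "shuffle k n a"]
  by (intro sum_mono levels_sum_shuffle_le) simp

lemma transported_if_energy_constant: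
  assumes "\<And>c. energy c (shuffle k n a) = energy c a"
  shows "transported a"
proof (rule transported_if_levels_eq)
  fix l c assume l: "l < n"
  have "\<Sum>(\<phi> ` high (shuffle k n a) c (block k l)) = \<Sum>(\<phi> ` high a c (column k n l))"
    by (rule sum_mono_inv[OF assms[of c, unfolded energy_columns[of c a] energy_blocks[of c "shuffle k n a"]]])
      (use l levels_sum_shuffle_le in auto)
  then show "\<phi> ` high a c (column k n l) = \<phi> ` high (shuffle k n a) c (block k l)"
    using levels_sum_shuffle_less[OF l, of a c] by fastforce
qed

lemma periodic_transported:
  assumes "periodic k n a"
  shows "transported ((shuffle k n ^^ s) a)"
proof (rule transported_if_energy_constant)
  fix c
  let ?b = "\<lambda>s. (shuffle k n ^^ s) a"
  obtain t where t: "t > 0" "?b t = a" using assms by (auto simp: periodic_def)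
  have anti: "energy c (?b j) \<le> energy c (?b i)" if "i \<le> j" for i j
    using that by (rule lift_Suc_antimono_le[rotated]) (simp add: energy_shuffle_le)
  have "?b (s + t) = ?b s" using t by (simp add: funpow_add)
  then have "energy c (?b s) \<le> energy c (?b (Suc s))" using anti[of "Suc s" "s + t"] t by simp
  then show "energy c (shuffle k n (?b s)) = energy c (?b s)"
    using anti[of s "Suc s"] by simp
qed

section \<open>Edges of the periodic poset\<close>

text \<open>
  Two comparable subscripts of a column are joined by a chain of \<open>\<phi>\<close>-neighbours; each
  neighbouring pair comes by \<open>\<pi>\<^sup>s\<close> from an edge.
\<close>

lemma edges_column_decreasing:
  fixes a b :: "'a::linorder list"
  assumes edges: "\<And>A B. periodic_poset_edge k n \<phi> A B \<Longrightarrow> a ! A \<le> a ! B"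
    and moved: "\<And>x. x < k * n \<Longrightarrow> b ! (\<pi> ^^ s) x = a ! x"
    and l: "l < n"
  shows "x \<in> column k n l \<Longrightarrow> y \<in> column k n l \<Longrightarrow> \<phi> y < \<phi> x \<Longrightarrow> b ! x \<le> b ! y"
proof (induction "card {e \<in> column k n l. \<phi> y < \<phi> e \<and> \<phi> e < \<phi> x}" arbitrary: x y
    rule: less_induct)
  case less
  let ?between = "\<lambda>x y. {e \<in> column k n l. \<phi> y < \<phi> e \<and> \<phi> e < \<phi> x}"
  show ?case
  proof (cases "?between x y = {}")
    case True
    have "(\<pi> ^^ s) ` {..<k * n} = {..<k * n}"
      using permutes_image[OF permutes_funpow[OF weight_perm_permutes]] .
    moreover have "x \<in> {..<k * n}" "y \<in> {..<k * n}"
      using less.prems l by (auto simp: mem_column_iff)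
    ultimately have "x \<in> (\<pi> ^^ s) ` {..<k * n}" "y \<in> (\<pi> ^^ s) ` {..<k * n}" by simp_all
    then obtain A B where AB: "A < k * n" "x = (\<pi> ^^ s) A" "B < k * n" "y = (\<pi> ^^ s) B"
      by blast
    then have "\<phi> B < \<phi> A" using less.prems funpow_weight_perm(2) by simp
    moreover have "\<exists>s l. l < n \<and> (\<pi> ^^ s) A \<in> column k n l \<and> (\<pi> ^^ s) B \<in> column k n l \<and>
      \<not> (\<exists>e\<in>column k n l. \<phi> ((\<pi> ^^ s) B) < \<phi> e \<and> \<phi> e < \<phi> ((\<pi> ^^ s) A))"
      using True less.prems l AB by (intro exI[of _ s] exI[of _ l]) auto
    ultimately have "periodic_poset_edge k n \<phi> A B"
      using AB by (auto simp: periodic_poset_edge_def Let_def)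
    then show ?thesis using edges[of A B] moved AB by simp
  next
    case False
    then obtain e where e: "e \<in> column k n l" "\<phi> y < \<phi> e" "\<phi> e < \<phi> x" by auto
    have "card (?between x e) < card (?between x y)" "card (?between e y) < card (?between x y)"
      using e by (intro psubset_card_mono; force simp: finite_column)+
    then have "b ! x \<le> b ! e" "b ! e \<le> b ! y"
      using less.hyps less.prems e by auto
    then show ?thesis by simp
  qed
qed

lemma edges_transported:
  assumes "\<And>A B. periodic_poset_edge k n \<phi> A B \<Longrightarrow> a ! A \<le> a ! B"
  shows "transported ((shuffle k n ^^ s) a)"
proof (induction s rule: less_induct)
  case (less s)
  show ?case
    by (rule transported_if_decreasing)
      (rule edges_column_decreasing[OF assms nth_funpow_shuffle[OF less]])
qed

end

theorem mainTheorem4: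
  fixes k n :: nat
    and \<phi> :: "nat \<Rightarrow> int"
    and a :: "'a::{finite, linorder} list"
  assumes "k \<ge> 2"
    and "n \<ge> 1"
    and "shuffling_weight k n \<phi>"
    and "length a = k * n"
  shows "periodic k n a \<longleftrightarrow>
    (\<forall>A B. periodic_poset_edge k n \<phi> A B \<longrightarrow> a ! B \<ge> a ! A)"
proof -
  interpret weighted_shuffling k n \<phi> using assms by unfold_locales auto
  show ?thesis
  proof (intro iffI allI impI)
    fix A B assume per: "periodic k n a" and edge: "periodic_poset_edge k n \<phi> A B"
    from edge obtain s l where less: "A < k * n" "B < k * n" "\<phi> B < \<phi> A" and l: "l < n"
      and col: "(\<pi> ^^ s) A \<in> column k n l" "(\<pi> ^^ s) B \<in> column k n l"
      by (auto simp: periodic_poset_edge_def Let_def)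
    have "(shuffle k n ^^ s) a ! (\<pi> ^^ s) A \<le> (shuffle k n ^^ s) a ! (\<pi> ^^ s) B"
      using transported_decreasing[OF periodic_transported[OF per] l col] less
        funpow_weight_perm(2) by simp
    then show "a ! A \<le> a ! B"
      using nth_funpow_shuffle[OF periodic_transported[OF per]] less by simp
  next
    assume edges: "\<forall>A B. periodic_poset_edge k n \<phi> A B \<longrightarrow> a ! A \<le> a ! B"
    have "permutation \<pi>" 
      unfolding permutation_permutes using weight_perm_permutes by blast
    then obtain t where t: "\<pi> ^^ t = id" "t > 0" by (rule permutation_is_nilpotent)
    have "(shuffle k n ^^ t) a = a"
    proof (rule nth_equalityI)
      show "length ((shuffle k n ^^ t) a) = length a"
        using t assms(4) by (cases t) auto
      then show "(shuffle k n ^^ t) a ! x = a ! x" if "x < length ((shuffle k n ^^ t) a)" for x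
        using nth_funpow_shuffle[of t a x] edges_transported[of a] edges t that assms(4) by simp
    qed
    then show "periodic k n a" using t by (auto simp: periodic_def)
  qed
qed

end
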